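(* Let $X$ and $Y$ be positive Markov processes with pointwise generators $\mathcal{X}$ and $\mathcal{Y}$, respectively. (1) If $X$ is in $(\star_1,\star_2)$-Laplace duality with $Y$ and if (under the conventions $\star_1,\star_2$) for given $(x,y)\in[0,\infty]^2$ we have $\mathsf{e}^y\in D_{\mathcal{X}}$ and $\mathsf{e}_x\in D_{\mathcal{Y}}$, then $\mathcal{X}\mathsf{e}^y(x)=\mathcal{Y}\mathsf{e}_x(y)$. (2) Assume $\{\mathsf{e}_x:x\in(0,\infty)\}=\{\mathsf{e}^y:y\in(0,\infty)\}\subset D_{\mathcal{X}}\cap D_{\mathcal{Y}}$. Then: $\mathcal{X}$ and $\mathcal{Y}$ are in Laplace duality if and only if the Laplace symbols $\psi_X$ and $\psi_Y$ are in duality; and if $X$ is in Laplace duality (of whichever kind, i.e. for some choice of $\star_1,\star_2$) with $Y$, then $\mathcal{X}$ and $\mathcal{Y}$ are in Laplace duality.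
   Context: Positive Markov process: a time-homogeneous Markov process with values in $[0,\infty]$ (Borel $\sigma$-field), under probabilities $(\mathbb{P}_x)_{x\in[0,\infty]}$ on a common measurable space, with $x\mapsto\mathbb{P}_x(X_t\in A)$ Borel, $\mathbb{P}_x(X_0=x)=1$ and the Markov property. $P_tf(x)=\mathbb{E}_x[f(X_t)]$. The pointwise generator $\mathcal{X}$ has domain $D_{\mathcal{X}}$ consisting of all bounded Borel $f:[0,\infty]\to\mathbb{R}$ for which $\mathcal{X}f(x):=\lim_{t\downarrow0}\frac{P_tf(x)-f(x)}{t}$ exists in $\mathbb{R}$ for every $x\in[0,\infty]$. For $Y$: laws $\mathbb{P}^y$, expectations $\mathbb{E}^y$, generator $\mathcal{Y}$. Conventions: $e^{-\infty}=0$, and $x\cdot\infty=\infty\cdot x=\infty$ for $x\in(0,\infty]$. $\star_1\in\{0^+\cdot\infty,0\cdot\infty^-\}$ and $\star_2\in\{\infty\cdot0^+,\infty^-\cdot0\}$. Under $0^+\cdot\infty$ one interprets $e^{-0\cdot\infty}=0$; under $0\cdot\infty^-$, $e^{-0\cdot\infty}=1$; under $\infty\cdot 0^+$, $e^{-\infty\cdot 0}=0$; under $\infty^-\cdot 0$, $e^{-\infty\cdot 0}=1$. In products the first factor refers to the $X$-variable and the second to the $Y$-variable. $X$ is in $(\star_1,\star_2)$-Laplace duality with $Y$ if $\mathbb{E}_x[e^{-X_ty}]=\mathbb{E}^y[e^{-xY_t}]$ for all $t\in[0,\infty)$, $(x,y)\in[0,\infty]^2$, under these conventions. $\mathsf{e}^y(u)=e^{-uy}$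 and $\mathsf{e}_x(v)=e^{-xv}$ for $u,v,x,y\in[0,\infty]$, under the conventions in force (for $x,y\in(0,\infty)$ no convention is needed). Generators $\mathcal{X}$, $\mathcal{Y}$ whose domains contain $\{\mathsf{e}^y:y\in(0,\infty)\}$ are in Laplace duality if $(\mathcal{X}\mathsf{e}^y)(x)=(\mathcal{Y}\mathsf{e}_x)(y)$ for all $x,y\in(0,\infty)$. When $\{\mathsf{e}^y:y\in(0,\infty)\}\subset D_{\mathcal{X}}$, the Laplace symbol $\psi_X:[0,\infty]\times(0,\infty)\to\mathbb{R}$ of $X$ is given by $\psi_X(x,y)=e^{xy}(\mathcal{X}\mathsf{e}^y)(x)$ for $x\in[0,\infty)$ and $\psi_X(\infty,y)=(\mathcal{X}\mathsf{e}^y)(\infty)$; analogously $\psi_Y$. $\psi_X$ and $\psi_Y$ are in duality if $\psi_X(x,y)=\psi_Y(y,x)$ for all $x,y\in(0,\infty)$. *)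

theory Defs
  imports "HOL-Probability.Probability"
begin

definition natural_filtration ::
  "'w measure \<Rightarrow> (real \<Rightarrow> 'w \<Rightarrow> ennreal) \<Rightarrow> real \<Rightarrow> 'w measure" where
  "natural_filtration M X t =
     sigma (space M) {X u -` A \<inter> space M | u A. 0 \<le> u \<and> u \<le> t \<and> A \<in> sets borel}"

text \<open>The state space $[0,\infty]$ is \<^typ>\<open>ennreal\<close> and the time set is $[0,\infty)$, i.e. the
  values of \<^term>\<open>X t\<close> for \<^prop>\<open>t < 0\<close> are irrelevant. Only the measurable structure of \<open>M\<close>
  matters. The Markov property is the one relative to the natural filtration, which is the weakest
  choice of filtration.\<close>

locale positive_markov_process =
  fixes M :: "'w measure"
    and P :: "ennreal \<Rightarrow> 'w measure"
    and X :: "real \<Rightarrow> 'w \<Rightarrow> ennreal"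
  assumes prob_space_P: "\<And>x. prob_space (P x)"
    and sets_P: "\<And>x. sets (P x) = sets M"
    and measurable_X: "\<And>t. 0 \<le> t \<Longrightarrow> X t \<in> measurable M borel"
    and measurable_transition: "\<And>t A. 0 \<le> t \<Longrightarrow> A \<in> sets borel \<Longrightarrow>
          (\<lambda>x. measure (P x) {\<omega> \<in> space M. X t \<omega> \<in> A}) \<in> borel_measurable borel"
    and initial: "\<And>x. AE \<omega> in P x. X 0 \<omega> = x"
    and Markov: "\<And>x s t A. 0 \<le> s \<Longrightarrow> 0 \<le> t \<Longrightarrow> A \<in> sets borel \<Longrightarrow>
          AE \<omega> in P x.
            real_cond_exp (P x) (natural_filtration M X s)
              (indicator {\<omega>' \<in> space M. X (s + t) \<omega>' \<in> A}) \<omega>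
            = measure (P (X s \<omega>)) {\<omega>' \<in> space M. X t \<omega>' \<in> A}"

definition markov_semigroup ::
  "(ennreal \<Rightarrow> 'w measure) \<Rightarrow> (real \<Rightarrow> 'w \<Rightarrow> ennreal) \<Rightarrow> real \<Rightarrow> (ennreal \<Rightarrow> real) \<Rightarrow> ennreal \<Rightarrow> real" where
  "markov_semigroup P X t f x = (LINT \<omega>|P x. f (X t \<omega>))"

definition generator_domain ::
  "(ennreal \<Rightarrow> 'w measure) \<Rightarrow> (real \<Rightarrow> 'w \<Rightarrow> ennreal) \<Rightarrow> (ennreal \<Rightarrow> real) set" where
  "generator_domain P X =
     {f. f \<in> borel_measurable borel \<and> bounded (range f) \<and>
         (\<forall>x. \<exists>l::real. ((\<lambda>t. (markov_semigroup P X t f x - f x) / t) \<longlongrightarrow> l) (at_right 0))}"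

text \<open>Only meaningful for \<open>f\<close> in \<^const>\<open>generator_domain\<close>.\<close>

definition generator ::
  "(ennreal \<Rightarrow> 'w measure) \<Rightarrow> (real \<Rightarrow> 'w \<Rightarrow> ennreal) \<Rightarrow> (ennreal \<Rightarrow> real) \<Rightarrow> ennreal \<Rightarrow> real" where
  "generator P X f x = Lim (at_right 0) (\<lambda>t. (markov_semigroup P X t f x - f x) / t)"

text \<open>The conventions $\star_1 \in \{0^+\cdot\infty, 0\cdot\infty^-\}$ and
  $\star_2 \in \{\infty\cdot 0^+, \infty^-\cdot 0\}$.\<close>

datatype star1 = ZeroPlus_Inf | Zero_InfMinus
datatype star2 = Inf_ZeroPlus | InfMinus_Zero

definition exp_minus :: "ennreal \<Rightarrow> real" where
  "exp_minus z = (if z = \<infinity> then 0 else exp (- enn2real z))"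

text \<open>\<open>laplace_kernel s1 s2 u v\<close> is $e^{-uv}$ under the conventions \<open>s1\<close>, \<open>s2\<close>, where \<open>u\<close> is the
  variable of the first process and \<open>v\<close> that of the second. In \<^typ>\<open>ennreal\<close> one has
  \<open>0 * \<infinity> = \<infinity> * 0 = 0\<close>, so the two indeterminate products are treated separately.\<close>

definition laplace_kernel :: "star1 \<Rightarrow> star2 \<Rightarrow> ennreal \<Rightarrow> ennreal \<Rightarrow> real" where
  "laplace_kernel s1 s2 u v =
     (if u = 0 \<and> v = \<infinity> then (case s1 of ZeroPlus_Inf \<Rightarrow> 0 | Zero_InfMinus \<Rightarrow> 1)
      else if u = \<infinity> \<and> v = 0 then (case s2 of Inf_ZeroPlus \<Rightarrow> 0 | InfMinus_Zero \<Rightarrow> 1)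
      else exp_minus (u * v))"

text \<open>$\mathsf{e}^y$ (superscript) and $\mathsf{e}_x$ (subscript).\<close>

definition e_sup :: "star1 \<Rightarrow> star2 \<Rightarrow> ennreal \<Rightarrow> ennreal \<Rightarrow> real" where
  "e_sup s1 s2 y = (\<lambda>u. laplace_kernel s1 s2 u y)"

definition e_sub :: "star1 \<Rightarrow> star2 \<Rightarrow> ennreal \<Rightarrow> ennreal \<Rightarrow> real" where
  "e_sub s1 s2 x = (\<lambda>v. laplace_kernel s1 s2 x v)"

definition laplace_duality ::
  "star1 \<Rightarrow> star2 \<Rightarrow>
   (ennreal \<Rightarrow> 'w measure) \<Rightarrow> (real \<Rightarrow> 'w \<Rightarrow> ennreal) \<Rightarrow>
   (ennreal \<Rightarrow> 'v measure) \<Rightarrow> (real \<Rightarrow> 'v \<Rightarrow> ennreal) \<Rightarrow> bool" where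
  "laplace_duality s1 s2 P X Q Y \<longleftrightarrow>
     (\<forall>t\<ge>0. \<forall>x y. (LINT \<omega>|P x. laplace_kernel s1 s2 (X t \<omega>) y)
                = (LINT \<omega>|Q y. laplace_kernel s1 s2 x (Y t \<omega>)))"

text \<open>For \<open>a \<in> (0,\<infinity>)\<close> the functions $\mathsf{e}^a$ and $\mathsf{e}_a$ coincide and do not depend on
  the conventions; their common value is \<open>e_pos a\<close>. It is only used for such \<open>a\<close>.\<close>

definition e_pos :: "ennreal \<Rightarrow> ennreal \<Rightarrow> real" where
  "e_pos a = (\<lambda>u. exp_minus (u * a))"

lemma e_sup_eq_e_pos: "0 < y \<Longrightarrow> y < \<infinity> \<Longrightarrow> e_sup s1 s2 y = e_pos y"
  by (auto simp: e_sup_def e_pos_def laplace_kernel_def fun_eq_iff)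

lemma e_sub_eq_e_pos: "0 < x \<Longrightarrow> x < \<infinity> \<Longrightarrow> e_sub s1 s2 x = e_pos x"
  by (auto simp: e_sub_def e_pos_def laplace_kernel_def fun_eq_iff mult.commute)

lemma e_sub_image_eq_e_sup_image:
  "e_sub s1 s2 ` {0<..<\<infinity>} = e_sup s1' s2' ` {0<..<\<infinity>}"
  by (intro image_cong) (auto simp: e_sup_eq_e_pos e_sub_eq_e_pos)

definition generators_laplace_dual ::
  "(ennreal \<Rightarrow> 'w measure) \<Rightarrow> (real \<Rightarrow> 'w \<Rightarrow> ennreal) \<Rightarrow>
   (ennreal \<Rightarrow> 'v measure) \<Rightarrow> (real \<Rightarrow> 'v \<Rightarrow> ennreal) \<Rightarrow> bool" where
  "generators_laplace_dual P X Q Y \<longleftrightarrow>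
     e_pos ` {0<..<\<infinity>} \<subseteq> generator_domain P X \<and>
     e_pos ` {0<..<\<infinity>} \<subseteq> generator_domain Q Y \<and>
     (\<forall>x\<in>{0<..<\<infinity>}. \<forall>y\<in>{0<..<\<infinity>}.
        generator P X (e_pos y) x = generator Q Y (e_pos x) y)"

text \<open>Only meaningful when \<open>a \<in> (0,\<infinity>)\<close> and \<open>e_pos a\<close> is in the domain of the generator.\<close>

definition laplace_symbol ::
  "(ennreal \<Rightarrow> 'w measure) \<Rightarrow> (real \<Rightarrow> 'w \<Rightarrow> ennreal) \<Rightarrow> ennreal \<Rightarrow> ennreal \<Rightarrow> real" where
  "laplace_symbol P X u a =
     (if u = \<infinity> then generator P X (e_pos a) \<infinity>
      else exp (enn2real (u * a)) * generator P X (e_pos a) u)"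

definition symbols_in_duality ::
  "(ennreal \<Rightarrow> ennreal \<Rightarrow> real) \<Rightarrow> (ennreal \<Rightarrow> ennreal \<Rightarrow> real) \<Rightarrow> bool" where
  "symbols_in_duality \<psi> \<phi> \<longleftrightarrow> (\<forall>x\<in>{0<..<\<infinity>}. \<forall>y\<in>{0<..<\<infinity>}. \<psi> x y = \<phi> y x)"

end

theory Submission
  imports Defs
begin

text \<open>Both semigroups act on the same kernel: Laplace duality says that
  $P_t \mathsf{e}^y(x) = Q_t \mathsf{e}_x(y)$ for all \<open>t \<ge> 0\<close>, and
  $\mathsf{e}^y(x) = \mathsf{e}_x(y)$ is the kernel at \<open>(x, y)\<close>. The two difference quotients
  therefore coincide for every \<open>t > 0\<close>, and so do their limits as \<open>t\<close> decreases to \<open>0\<close>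
  (\<open>generator_eq_of_laplace_duality\<close>). For arguments in \<open>(0, \<infinity>)\<close> the kernel does not
  depend on the conventions, so the duality of the generators follows. The symbols differ from the
  generators only by the factor $e^{xy}$, which is nonzero and symmetric in \<open>x\<close> and \<open>y\<close>;
  hence the two forms of duality for generators agree.\<close>

lemma markov_semigroup_eq_of_laplace_duality:
  assumes "laplace_duality s1 s2 P X Q Y" "0 \<le> t"
  shows "markov_semigroup P X t (e_sup s1 s2 y) x = markov_semigroup Q Y t (e_sub s1 s2 x) y"
  using assms by (simp add: laplace_duality_def markov_semigroup_def e_sup_def e_sub_def)

text \<open>Functions that agree eventually along a filter have the same \<^const>\<open>Lim\<close>, also when they
  do not converge; so the equality holds outside the domains as well.\<close>

lemma generator_eq_of_laplace_duality:
  assumes "laplace_duality s1 s2 P X Q Y"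
  shows "generator P X (e_sup s1 s2 y) x = generator Q Y (e_sub s1 s2 x) y"
proof -
  have "eventually (\<lambda>t. (markov_semigroup P X t (e_sup s1 s2 y) x - e_sup s1 s2 y x) / t
      = (markov_semigroup Q Y t (e_sub s1 s2 x) y - e_sub s1 s2 x y) / t) (at_right (0::real))"
    using eventually_at_right_less[of "0::real"]
  proof eventually_elim
    case (elim t)
    then show ?case
      using markov_semigroup_eq_of_laplace_duality[OF assms, of t y x]
      by (simp add: e_sup_def e_sub_def)
  qed
  then show ?thesis
    unfolding generator_def by (rule Lim_cong[OF _ refl])
qed

lemma generator_e_pos_eq_of_laplace_duality:
  assumes "laplace_duality s1 s2 P X Q Y"
    and "x \<in> {0<..<\<infinity>}" "y \<in> {0<..<\<infinity>}"
  shows "generator P X (e_pos y) x = generator Q Y (e_pos x) y"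
  using generator_eq_of_laplace_duality[OF assms(1), of y x] assms(2,3)
  by (simp add: e_sup_eq_e_pos e_sub_eq_e_pos)

lemma symbols_in_duality_iff_generators:
  "symbols_in_duality (laplace_symbol P X) (laplace_symbol Q Y) \<longleftrightarrow>
     (\<forall>x\<in>{0<..<\<infinity>}. \<forall>y\<in>{0<..<\<infinity>}.
        generator P X (e_pos y) x = generator Q Y (e_pos x) y)"
  unfolding symbols_in_duality_def
proof (intro ball_cong refl)
  fix x y :: ennreal
  assume "x \<in> {0<..<\<infinity>}" "y \<in> {0<..<\<infinity>}"
  then show "laplace_symbol P X x y = laplace_symbol Q Y y x \<longleftrightarrow>
      generator P X (e_pos y) x = generator Q Y (e_pos x) y"
    by (simp add: laplace_symbol_def mult.commute[of y x] less_top[symmetric])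
qed

theorem theorem4p7:
  fixes M :: "'w measure" and P :: "ennreal \<Rightarrow> 'w measure" and X :: "real \<Rightarrow> 'w \<Rightarrow> ennreal"
    and N :: "'v measure" and Q :: "ennreal \<Rightarrow> 'v measure" and Y :: "real \<Rightarrow> 'v \<Rightarrow> ennreal"
  assumes "positive_markov_process M P X"
    and "positive_markov_process N Q Y"
  shows
    "(\<forall>s1 s2. laplace_duality s1 s2 P X Q Y \<longrightarrow>
        (\<forall>x y. e_sup s1 s2 y \<in> generator_domain P X \<longrightarrow> e_sub s1 s2 x \<in> generator_domain Q Y \<longrightarrow>
           generator P X (e_sup s1 s2 y) x = generator Q Y (e_sub s1 s2 x) y))
     \<and>
     (e_pos ` {0<..<\<infinity>} \<subseteq> generator_domain P X \<inter> generator_domain Q Y \<longrightarrow>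
        (generators_laplace_dual P X Q Y \<longleftrightarrow>
           symbols_in_duality (laplace_symbol P X) (laplace_symbol Q Y)) \<and>
        ((\<exists>s1 s2. laplace_duality s1 s2 P X Q Y) \<longrightarrow> generators_laplace_dual P X Q Y))"
proof (intro conjI impI allI)
  fix s1 s2 x y
  assume "laplace_duality s1 s2 P X Q Y"
  then show "generator P X (e_sup s1 s2 y) x = generator Q Y (e_sub s1 s2 x) y"
    by (rule generator_eq_of_laplace_duality)
next
  assume "e_pos ` {0<..<\<infinity>} \<subseteq> generator_domain P X \<inter> generator_domain Q Y"
  then show "generators_laplace_dual P X Q Y \<longleftrightarrow>
      symbols_in_duality (laplace_symbol P X) (laplace_symbol Q Y)"
    by (simp add: generators_laplace_dual_def symbols_in_duality_iff_generators)
next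
  assume "e_pos ` {0<..<\<infinity>} \<subseteq> generator_domain P X \<inter> generator_domain Q Y"
    and "\<exists>s1 s2. laplace_duality s1 s2 P X Q Y"
  then show "generators_laplace_dual P X Q Y"
    unfolding generators_laplace_dual_def
    using generator_e_pos_eq_of_laplace_duality by blast
qed

end
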